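(* Condition A4 holds for any metatangible, uniquely negated pair $(\mathcal A,\mathcal A_0)$: if $m>n$, then the rows of any $m\times n$ matrix over $\mathcal A$ are dependent.
   Context: $\mathcal T$ is a commutative multiplicative monoid with unit $1$; $\mathcal A$ is a $\mathcal T$-bimodule: a commutative additive semigroup $(\mathcal A,+,0)$ with zero and compatible left and right actions of $\mathcal T$ satisfying $a0=0$, $a(b_1+b_2)=ab_1+ab_2$, $1b=b$ (and right-hand versions), $(a_1b)a_2=a_1(ba_2)$, $(a_1a_2)b=a_1(a_2b)$. $\mathcal T_0=\mathcal T\cup\{0\}\subseteq\mathcal A$ ($0\notin\mathcal T$, $a1=1a=a$). Admissible: $\mathcal T_0$ spans $(\mathcal A,+)$. $\mathcal A_0$ is a sub-bimodule with $\mathcal A_0\cap\mathcal T_0=\{0\}$. Multiplication on $\mathcal A$: $(\sum a_i)(\sum a_j')=\sum a_ia_j'$ for $a_i,a_j'\in\mathcal T$. Standing assumptions: for $a\in\mathcal T$, $ab\in\mathcal A_0$ or $ba\in\mathcal A_0$ implies $b\in\mathcal A_0$; $ab_1=ab_2$ or $b_1a=b_2a$ implies $b_1=b_2$; $(k1)(k'1)=(kk')1$ for $k,k'\in\mathbb N^+$. A negation map is an automorphism $(-)$ of $(\mathcal A,+,0)$ of order $\le2$ leaving $\mathcal T$ invariant, with $1+((-)1)\in\mathcal A_0$, and $((-)a)b=(-)(ab)=a((-)b)$, $((-)b)a=(-)(ba)=b((-)a)$ for $a\in\mathcal T$. Uniquely negated: there is a negation map, and $a+a'\in\mathcal A_0$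 with $a,a'\in\mathcal T$ implies $a'=(-)a$. The pair is metatangible if it is admissible, $a_1+a_2\in\mathcal T\cup\mathcal A_0$ for all $a_1,a_2\in\mathcal T$, and Property N holds (which follows here from unique negation: $a_1+a_2=a_1+((-)a_1)$ whenever $a_1,a_2\in\mathcal T$ and $a_1+a_2\in\mathcal A_0$). Vectors $\mathbf v_i\in\mathcal A^{(n)}$ ($i\in I$) are dependent if $\sum_{i\in I'}a_i\mathbf v_i\in\mathcal A_0^{(n)}$ for some nonempty finite $I'\subseteq I$ and $a_i\in\mathcal T$. *)

theory Defs
  imports "Jordan_Normal_Form.Matrix"
begin

text \<open>The monoid \<open>\<T>\<close> is the type \<open>'t\<close> and the additive semigroup with zero \<open>\<A>\<close> is the type \<open>'a\<close>.\<close>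

locale T_bimodule =
  fixes lact :: "'t::comm_monoid_mult \<Rightarrow> 'a::comm_monoid_add \<Rightarrow> 'a" (infixr "\<cdot>\<^sub>l" 75)
    and ract :: "'a \<Rightarrow> 't \<Rightarrow> 'a" (infixl "\<cdot>\<^sub>r" 75)
  assumes lact_zero: "a \<cdot>\<^sub>l 0 = 0"
    and lact_add: "a \<cdot>\<^sub>l (b\<^sub>1 + b\<^sub>2) = (a \<cdot>\<^sub>l b\<^sub>1) + (a \<cdot>\<^sub>l b\<^sub>2)"
    and lact_one: "1 \<cdot>\<^sub>l b = b"
    and lact_mult: "(a\<^sub>1 * a\<^sub>2) \<cdot>\<^sub>l b = a\<^sub>1 \<cdot>\<^sub>l (a\<^sub>2 \<cdot>\<^sub>l b)"
    and ract_zero: "0 \<cdot>\<^sub>r a = 0"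
    and ract_add: "(b\<^sub>1 + b\<^sub>2) \<cdot>\<^sub>r a = (b\<^sub>1 \<cdot>\<^sub>r a) + (b\<^sub>2 \<cdot>\<^sub>r a)"
    and ract_one: "b \<cdot>\<^sub>r 1 = b"
    and ract_mult: "b \<cdot>\<^sub>r (a\<^sub>1 * a\<^sub>2) = (b \<cdot>\<^sub>r a\<^sub>1) \<cdot>\<^sub>r a\<^sub>2"
    and lact_ract: "(a\<^sub>1 \<cdot>\<^sub>l b) \<cdot>\<^sub>r a\<^sub>2 = a\<^sub>1 \<cdot>\<^sub>l (b \<cdot>\<^sub>r a\<^sub>2)"

text \<open>The inclusion of \<open>\<T>\<close> in \<open>\<A>\<close> is the injection \<open>emb\<close>; thus \<open>\<T>\<^sub>0\<close> is \<open>insert 0 (range emb)\<close>.\<close>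

locale T_pair = T_bimodule lact ract
  for lact :: "'t::comm_monoid_mult \<Rightarrow> 'a::comm_monoid_add \<Rightarrow> 'a" (infixr "\<cdot>\<^sub>l" 75)
    and ract :: "'a \<Rightarrow> 't \<Rightarrow> 'a" (infixl "\<cdot>\<^sub>r" 75) +
  fixes emb :: "'t \<Rightarrow> 'a"
    and A0 :: "'a set"
  assumes inj_emb: "inj emb"
    and zero_notin_T: "0 \<notin> range emb"
    and lact_emb_one: "a \<cdot>\<^sub>l emb 1 = emb a"
    and ract_emb_one: "emb 1 \<cdot>\<^sub>r a = emb a"
    and A0_zero: "0 \<in> A0"
    and A0_add: "b\<^sub>1 \<in> A0 \<Longrightarrow> b\<^sub>2 \<in> A0 \<Longrightarrow> b\<^sub>1 + b\<^sub>2 \<in> A0"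
    and A0_lact: "b \<in> A0 \<Longrightarrow> a \<cdot>\<^sub>l b \<in> A0"
    and A0_ract: "b \<in> A0 \<Longrightarrow> b \<cdot>\<^sub>r a \<in> A0"
    and A0_Int_T0: "A0 \<inter> insert 0 (range emb) = {0}"

locale admissible_pair = T_pair +
  assumes T0_spans: "\<exists>xs. set xs \<subseteq> insert 0 (range emb) \<and> b = sum_list xs"

text \<open>The multiplication of \<open>\<A>\<close> induced by that of \<open>\<T>\<close>. It is well defined for admissible
  pairs, see \<open>pair_mult_sum_list\<close> below.\<close>

definition pair_mult :: "('t::comm_monoid_mult \<Rightarrow> 'a::comm_monoid_add) \<Rightarrow> 'a \<Rightarrow> 'a \<Rightarrow> 'a" where
  "pair_mult emb x y =
    (THE z. \<forall>as as'. x = sum_list (map emb as) \<and> y = sum_list (map emb as') \<longrightarrow>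
       z = (\<Sum>a\<leftarrow>as. \<Sum>a'\<leftarrow>as'. emb (a * a')))"

context T_pair
begin

lemma lact_emb: "a \<cdot>\<^sub>l emb b = emb (a * b)"
  by (metis lact_emb_one lact_mult)

lemma emb_ract: "emb b \<cdot>\<^sub>r a = emb (b * a)"
  by (metis ract_emb_one ract_mult)

lemma lact_sum_list: "a \<cdot>\<^sub>l sum_list (map f xs) = (\<Sum>x\<leftarrow>xs. a \<cdot>\<^sub>l f x)"
  by (induction xs) (simp_all add: lact_zero lact_add)

lemma ract_sum_list: "sum_list (map f xs) \<cdot>\<^sub>r a = (\<Sum>x\<leftarrow>xs. f x \<cdot>\<^sub>r a)"
  by (induction xs) (simp_all add: ract_zero ract_add)

lemma double_sum_left:
  "(\<Sum>a\<leftarrow>as. \<Sum>a'\<leftarrow>as'. emb (a * a')) = (\<Sum>a\<leftarrow>as. a \<cdot>\<^sub>l sum_list (map emb as'))"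
  by (simp add: lact_sum_list lact_emb)

lemma double_sum_right:
  "(\<Sum>a\<leftarrow>as. \<Sum>a'\<leftarrow>as'. emb (a * a')) = (\<Sum>a'\<leftarrow>as'. sum_list (map emb as) \<cdot>\<^sub>r a')"
proof (induction as)
  case Nil
  then show ?case by (simp add: ract_zero)
next
  case (Cons a as)
  then show ?case by (simp add: ract_add emb_ract sum_list_addf)
qed

lemma pair_mult_sum_list:
  "pair_mult emb (sum_list (map emb as)) (sum_list (map emb as')) =
    (\<Sum>a\<leftarrow>as. \<Sum>a'\<leftarrow>as'. emb (a * a'))"
  unfolding pair_mult_def
proof (rule the_equality, intro allI impI)
  fix bs bs'
  assume "sum_list (map emb as) = sum_list (map emb bs) \<and>
    sum_list (map emb as') = sum_list (map emb bs')"
  then show "(\<Sum>a\<leftarrow>as. \<Sum>a'\<leftarrow>as'. emb (a * a')) = (\<Sum>a\<leftarrow>bs. \<Sum>a'\<leftarrow>bs'. emb (a * a'))"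
    by (metis double_sum_left double_sum_right)
qed blast

end

locale standing_pair = admissible_pair +
  assumes lact_in_A0: "a \<cdot>\<^sub>l b \<in> A0 \<Longrightarrow> b \<in> A0"
    and ract_in_A0: "b \<cdot>\<^sub>r a \<in> A0 \<Longrightarrow> b \<in> A0"
    and lact_cancel: "a \<cdot>\<^sub>l b\<^sub>1 = a \<cdot>\<^sub>l b\<^sub>2 \<Longrightarrow> b\<^sub>1 = b\<^sub>2"
    and ract_cancel: "b\<^sub>1 \<cdot>\<^sub>r a = b\<^sub>2 \<cdot>\<^sub>r a \<Longrightarrow> b\<^sub>1 = b\<^sub>2"
    and mult_multiples_of_one: "(k::nat) > 0 \<Longrightarrow> (k'::nat) > 0 \<Longrightarrow>
      pair_mult emb (\<Sum>i<k. emb 1) (\<Sum>i<k'. emb 1) = (\<Sum>i<k * k'. emb 1)"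

text \<open>In \<open>neg_T\<close> below, \<open>a'\<close> is the element of \<open>\<T>\<close> that is the negation of \<open>a\<close>.\<close>

locale negated_pair = T_pair lact ract emb A0
  for lact :: "'t::comm_monoid_mult \<Rightarrow> 'a::comm_monoid_add \<Rightarrow> 'a" (infixr "\<cdot>\<^sub>l" 75)
    and ract :: "'a \<Rightarrow> 't \<Rightarrow> 'a" (infixl "\<cdot>\<^sub>r" 75)
    and emb :: "'t \<Rightarrow> 'a"
    and A0 :: "'a set" +
  fixes neg :: "'a \<Rightarrow> 'a"
  assumes neg_bij: "bij neg"
    and neg_zero: "neg 0 = 0"
    and neg_add: "neg (b\<^sub>1 + b\<^sub>2) = neg b\<^sub>1 + neg b\<^sub>2"
    and neg_neg: "neg (neg b) = b"
    and neg_range: "neg ` range emb = range emb"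
    and one_neg_one: "emb 1 + neg (emb 1) \<in> A0"
    and neg_T: "emb a' = neg (emb a) \<Longrightarrow> a' \<cdot>\<^sub>l b = neg (a \<cdot>\<^sub>l b) \<and> b \<cdot>\<^sub>r a' = neg (b \<cdot>\<^sub>r a)"
    and lact_neg: "a \<cdot>\<^sub>l neg b = neg (a \<cdot>\<^sub>l b)"
    and ract_neg: "neg b \<cdot>\<^sub>r a = neg (b \<cdot>\<^sub>r a)"

locale uniquely_negated_pair = negated_pair +
  assumes neg_unique: "emb a + emb a' \<in> A0 \<Longrightarrow> emb a' = neg (emb a)"

text \<open>The last assumption is Property N. It is expressed with the given negation map and is implied
  by \<open>neg_unique\<close>.\<close>

locale metatangible_pair = admissible_pair + negated_pair +
  assumes T_add: "emb a\<^sub>1 + emb a\<^sub>2 \<in> range emb \<union> A0"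
    and property_N: "emb a\<^sub>1 + emb a\<^sub>2 \<in> A0 \<Longrightarrow> emb a\<^sub>1 + emb a\<^sub>2 = emb a\<^sub>1 + neg (emb a\<^sub>1)"

definition A0_vec :: "'a set \<Rightarrow> nat \<Rightarrow> 'a vec set" where
  "A0_vec A0 n = {w \<in> carrier_vec n. \<forall>j<n. w $ j \<in> A0}"

definition dependent_vecs ::
  "('t \<Rightarrow> 'a::comm_monoid_add \<Rightarrow> 'a) \<Rightarrow> 'a set \<Rightarrow> nat \<Rightarrow> 'i set \<Rightarrow> ('i \<Rightarrow> 'a vec) \<Rightarrow> bool" where
  "dependent_vecs lact A0 n I v \<longleftrightarrow>
    (\<exists>I' a. I' \<subseteq> I \<and> finite I' \<and> I' \<noteq> {} \<and>
       vec n (\<lambda>j. \<Sum>i\<in>I'. lact (a i) (v i $ j)) \<in> A0_vec A0 n)"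

end

theory Submission
  imports Defs "HOL-Library.Multiset"
begin

text \<open>
  Over a valued field, \<open>m > n\<close> rows of length \<open>n\<close> satisfy a linear relation, and the leading terms of
  the coefficients satisfy the relation that the leading terms of the entries inherit. The proof
  imitates this. Every element of \<open>\<A>\<close> is the sum of an element of \<open>\<T>\<^sub>0\<close> and an element of \<open>\<A>\<^sub>0\<close>
  (\<open>tangible_plus_A0\<close>), so the entries may be taken in \<open>\<T>\<^sub>0\<close>. Metatangibility and unique negation
  give \<open>\<T>\<close> a valuation: for \<open>b\<close> different from \<open>a\<close> and \<open>(-)a\<close>, either \<open>b\<close> absorbs \<open>a\<close>, or \<open>a\<close> absorbs
  the quasi-zero \<open>b + (-)b\<close> (\<open>below_or_dominates\<close>). It follows that "\<open>a \<noteq> b\<close> and \<open>a + b = b\<close>" is a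
  strict weak order compatible with multiplication, and the sum of tangible elements depends only on
  those of the highest level.

  Addition inside one level is governed by one of three residue structures: a group (adjoining the
  quasi-zero as neutral element, as in a field), a single element \<open>t\<close> with \<open>t + t\<close> a quasi-zero, or a pair
  \<open>{t, (-)t}\<close> with idempotent addition. In each case there is a prime ideal \<open>P\<close> of the semiring of formal
  sums of tangible elements such that, modulo \<open>P\<close>, a formal sum outside \<open>P\<close> has a leading term \<open>k * t\<close>
  with a positive integer \<open>k\<close>, and such that a relation modulo \<open>P\<close> between formal sums forces the leading
  tangible elements to add up to an element of \<open>\<A>\<^sub>0\<close> (\<open>leading_terms_balance\<close>). The ideals compute the residues
  in the group itself, in the integers modulo \<open>2\<close> and in the integers (\<open>residue_group_ideal\<close>, \<open>parity_ideal\<close>,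
  \<open>signed_count_ideal\<close>). Fraction-free elimination modulo \<open>P\<close> (\<open>dependent_modulo_prime_ideal\<close>) produces a relation
  with coefficients in the formal sums, not all in \<open>P\<close>, and the leading tangible elements of the
  coefficients outside \<open>P\<close> are the coefficients asked for.
\<close>

section \<open>Linear dependence modulo a prime ideal of a commutative semiring\<close>

text \<open>Fraction-free Gaussian elimination. The element \<open>\<eta>\<close> plays the role of \<open>-1\<close>: a pivot \<open>v k n\<close>
outside \<open>P\<close> clears its column by passing from row \<open>i\<close> to \<open>v k n\<close> times row \<open>i\<close> plus \<open>\<eta> * v i n\<close>
times row \<open>k\<close>, and multiplying coefficients by the pivot keeps them outside \<open>P\<close> because \<open>P\<close> is prime.\<close>

lemma dependent_modulo_prime_ideal:
  fixes P :: "'r::comm_semiring_1 set" and v :: "'i \<Rightarrow> nat \<Rightarrow> 'r"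
  assumes zero: "0 \<in> P"
    and add: "\<And>x y. x \<in> P \<Longrightarrow> y \<in> P \<Longrightarrow> x + y \<in> P"
    and ideal: "\<And>x y. x \<in> P \<Longrightarrow> y * x \<in> P"
    and prime: "\<And>x y. x * y \<in> P \<Longrightarrow> x \<in> P \<or> y \<in> P"
    and proper: "1 \<notin> P"
    and opposite: "1 + \<eta> \<in> P"
    and "finite I" and "n < card I"
  shows "\<exists>a. (\<exists>i\<in>I. a i \<notin> P) \<and> (\<forall>j<n. (\<Sum>i\<in>I. a i * v i j) \<in> P)"
  using \<open>finite I\<close> \<open>n < card I\<close>
proof (induction n arbitrary: I v)
  case 0
  then have "I \<noteq> {}" by auto
  then show ?case using proper by (intro exI[of _ "\<lambda>_. 1"]) auto
next
  case (Suc n)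
  have sum_in: "(\<Sum>i\<in>J. f i) \<in> P" if "\<And>i. i \<in> J \<Longrightarrow> f i \<in> P" for J :: "'i set" and f
    using that by (induction J rule: infinite_finite_induct) (auto simp: zero add)
  show ?case
  proof (cases "\<forall>i\<in>I. v i n \<in> P")
    case True
    obtain a where a: "\<exists>i\<in>I. a i \<notin> P" "\<forall>j<n. (\<Sum>i\<in>I. a i * v i j) \<in> P"
      using Suc.IH[of I v] Suc.prems by auto
    have "(\<Sum>i\<in>I. a i * v i n) \<in> P"
      using True by (intro sum_in ideal) auto
    then show ?thesis using a by (metis less_Suc_eq)
  next
    case False
    then obtain k where k: "k \<in> I" "v k n \<notin> P" by blast
    define J where "J = I - {k}"
    have J: "finite J" "n < card J" "k \<notin> J" "I = insert k J"
      using Suc.prems k by (auto simp: J_def)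
    \<comment> \<open>The rows after elimination; column \<open>n\<close> of each is a multiple of \<open>1 + \<eta>\<close>.\<close>
    define w where "w i j = v k n * v i j + \<eta> * v i n * v k j" for i j
    obtain b where b: "\<exists>i\<in>J. b i \<notin> P" "\<forall>j<n. (\<Sum>i\<in>J. b i * w i j) \<in> P"
      using Suc.IH[of J w] J by auto
    \<comment> \<open>The coefficient of the pivot row collects the multiples of it that were added to the other rows.\<close>
    define a where "a i = (if i = k then \<eta> * (\<Sum>i\<in>J. b i * v i n) else v k n * b i)" for i
    have "\<exists>i\<in>I. a i \<notin> P"
      using b(1) k(2) prime J by (metis a_def insertCI)
    moreover have "(\<Sum>i\<in>I. a i * v i j) \<in> P" if "j < Suc n" for j
    proof -
      have "(\<Sum>i\<in>I. a i * v i j) = a k * v k j + (\<Sum>i\<in>J. a i * v i j)"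
        using J by simp
      also have "(\<Sum>i\<in>J. a i * v i j) = (\<Sum>i\<in>J. v k n * b i * v i j)"
        using J by (intro sum.cong) (auto simp: a_def)
      also have "a k * v k j + \<dots> = (\<Sum>i\<in>J. b i * w i j)"
        by (simp add: a_def w_def sum_distrib_left sum_distrib_right sum.distrib algebra_simps)
      also have "\<dots> \<in> P"
      proof (cases "j = n")
        case True
        have "b i * w i n = (b i * v k n * v i n) * (1 + \<eta>)" for i
          by (simp add: w_def algebra_simps)
        then show ?thesis using True opposite by (auto intro!: sum_in ideal)
      next
        case False
        then show ?thesis using b(2) that by auto
      qed
      finally show ?thesis .
    qed
    ultimately show ?thesis by blast
  qed
qed

section \<open>The semiring of formal sums of tangible elements\<close>

text \<open>This is the monoid semiring of \<open>'t\<close> with natural coefficients: a formal sum remembers its terms with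
multiplicity, which a sum formed in \<open>\<A>\<close> does not.\<close>

typedef 't formal_sum = "UNIV :: 't multiset set"
  morphisms terms formal_sum ..

setup_lifting type_definition_formal_sum

lemma mult_mset_right_add:
  fixes X Y Z :: "'t::comm_monoid_mult multiset"
  shows "(\<Sum>x\<in>#X. image_mset ((*) x) (Y + Z)) =
    (\<Sum>x\<in>#X. image_mset ((*) x) Y) + (\<Sum>x\<in>#X. image_mset ((*) x) Z)"
  by (induction X) (simp_all add: ac_simps)

lemma mult_mset_single:
  fixes X :: "'t::comm_monoid_mult multiset"
  shows "(\<Sum>x\<in>#X. image_mset ((*) x) {#y#}) = image_mset ((*) y) X"
  by (induction X) (simp_all add: ac_simps)

lemma mult_mset_commute:
  fixes X Y :: "'t::comm_monoid_mult multiset"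
  shows "(\<Sum>x\<in>#X. image_mset ((*) x) Y) = (\<Sum>y\<in>#Y. image_mset ((*) y) X)"
proof (induction Y)
  case empty
  then show ?case by (induction X) auto
next
  case (add y Y)
  then show ?case
    using mult_mset_right_add[where X = X and Y = Y and Z = "{#y#}"]
      mult_mset_single[where X = X and y = y]
    by (simp only: add_mset_add_single[of y Y] image_mset_union sum_mset.union
        image_mset_single sum_mset.singleton add.commute)
qed

instantiation formal_sum :: (comm_monoid_mult) comm_semiring_1
begin

lift_definition zero_formal_sum :: "'a formal_sum" is "{#}" .
lift_definition one_formal_sum :: "'a formal_sum" is "{#1#}" .
lift_definition plus_formal_sum :: "'a formal_sum \<Rightarrow> 'a formal_sum \<Rightarrow> 'a formal_sum" is "(+)" .
lift_definition times_formal_sum :: "'a formal_sum \<Rightarrow> 'a formal_sum \<Rightarrow> 'a formal_sum"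
  is "\<lambda>X Y. \<Sum>x\<in>#X. image_mset ((*) x) Y" .

instance
proof
  fix x y z :: "'a formal_sum"
  show "x + y + z = x + (y + z)" by transfer (simp add: ac_simps)
  show "x + y = y + x" by transfer (simp add: ac_simps)
  show "0 + x = x" by transfer simp
  show "0 * x = 0" by transfer simp
  show "x * 0 = 0" by transfer (simp add: sum_mset.neutral)
  show "1 * x = x" by transfer (simp add: image_mset_cong[of _ _ id])
  show "x * y = y * x" by transfer (rule mult_mset_commute)
  show "(x + y) * z = x * z + y * z" by transfer simp
  show "(0 :: 'a formal_sum) \<noteq> 1" by transfer simp
  show "x * y * z = x * (y * z)"
  proof transfer
    fix X Y Z :: "'a multiset"
    have image: "image_mset ((*) a) (\<Sum>y\<in>#Y. image_mset ((*) y) Z) =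
      (\<Sum>y\<in>#image_mset ((*) a) Y. image_mset ((*) y) Z)" for a
    proof -
      have "(*) (a * y) = (*) a \<circ> (*) y" for y
        by (simp add: fun_eq_iff mult.assoc)
      then show ?thesis
        by (induction Y) (simp_all add: multiset.map_comp)
    qed
    show "(\<Sum>w\<in>#(\<Sum>x\<in>#X. image_mset ((*) x) Y). image_mset ((*) w) Z) =
      (\<Sum>x\<in>#X. image_mset ((*) x) (\<Sum>x\<in>#Y. image_mset ((*) x) Z))"
      by (induction X) (simp_all add: image)
  qed
qed

end

lift_definition monomial :: "nat \<Rightarrow> 't \<Rightarrow> 't formal_sum" is replicate_mset .

lemma terms_zero [simp]: "terms 0 = {#}" by transfer simp
lemma terms_add [simp]: "terms (x + y) = terms x + terms y" by transfer simp
lemma terms_monomial [simp]: "terms (monomial k t) = replicate_mset k t" by transfer simp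
lemma terms_times: "terms (x * y) = (\<Sum>a\<in>#terms x. image_mset ((*) a) (terms y))" by transfer simp
lemma terms_monomial_times [simp]: "terms (monomial (Suc 0) t * y) = image_mset ((*) t) (terms y)"
  by (simp add: terms_times)
lemma formal_sum_eqI: "terms x = terms y \<Longrightarrow> x = y" by transfer simp

lemma monomial_one [simp]: "monomial (Suc 0) 1 = 1" by transfer simp

lemma monomial_add: "monomial k t + monomial l t = monomial (k + l) t"
  by (rule formal_sum_eqI) (simp add: multiset_eq_iff)

lemma monomial_Suc: "monomial (Suc k) t = monomial (Suc 0) t + monomial k t"
  by (simp add: monomial_add)

lemma monomial_0 [simp]: "monomial 0 t = 0" by transfer simp

lemma monomial_mult: "monomial k t * monomial l u = monomial (k * l) (t * u)"
proof -
  have unit: "monomial (Suc 0) t * monomial l u = monomial l (t * u)"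
    by (rule formal_sum_eqI) simp
  show ?thesis
  proof (induction k)
    case (Suc k)
    have "monomial (Suc k) t * monomial l u = monomial l (t * u) + monomial (k * l) (t * u)"
      unfolding monomial_Suc[of k t] distrib_right Suc unit ..
    then show ?case by (simp add: monomial_add)
  qed simp
qed

lemma in_terms_times: "w \<in># terms (x * y) \<longleftrightarrow> (\<exists>a\<in>#terms x. \<exists>b\<in>#terms y. w = a * b)"
  by (auto simp: terms_times)

lemma formal_sum_induct [case_names zero add]:
  assumes "Q 0" and "\<And>x u. Q x \<Longrightarrow> Q (x + monomial 1 u)"
  shows "Q x"
proof -
  have "Q (formal_sum X)" for X
  proof (induction X)
    case empty
    then show ?case using assms(1) by (simp add: zero_formal_sum_def)
  next
    case (add u X)
    have "formal_sum (add_mset u X) = formal_sum X + monomial 1 u"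
      by (rule formal_sum_eqI) (simp add: formal_sum_inverse)
    then show ?case using assms(2)[OF add] by simp
  qed
  then show ?thesis by (metis terms_inverse)
qed

section \<open>The valuation preorder on tangible elements\<close>

locale negated_metatangible_pair =
  standing_pair lact ract emb A0 +
  metatangible_pair lact ract emb A0 neg +
  uniquely_negated_pair lact ract emb A0 neg
  for lact :: "'t::comm_monoid_mult \<Rightarrow> 'a::comm_monoid_add \<Rightarrow> 'a" (infixr "\<cdot>\<^sub>l" 75)
    and ract :: "'a \<Rightarrow> 't \<Rightarrow> 'a" (infixl "\<cdot>\<^sub>r" 75)
    and emb :: "'t \<Rightarrow> 'a" and A0 :: "'a set" and neg :: "'a \<Rightarrow> 'a"
begin

text \<open>Multiplication by this tangible element is the negation map on \<open>\<T>\<close>.\<close>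

definition minus_one :: 't ("\<mu>") where
  "\<mu> = (SOME u. emb u = neg (emb 1))"

lemma emb_inject [simp]: "emb a = emb b \<longleftrightarrow> a = b"
  using inj_emb by (simp add: inj_eq)

lemma emb_nonzero [simp]: "emb a \<noteq> 0"
  using zero_notin_T by (metis rangeI)

lemma emb_notin_A0: "emb a \<notin> A0"
  using A0_Int_T0 emb_nonzero[of a] by blast

lemma emb_minus_one: "emb \<mu> = neg (emb 1)"
proof -
  have "neg (emb 1) \<in> range emb"
    using neg_range by blast
  then have "\<exists>u. emb u = neg (emb 1)" by (metis rangeE)
  then show ?thesis unfolding minus_one_def by (rule someI_ex)
qed

lemma emb_minus: "emb (\<mu> * a) = neg (emb a)"
  using neg_T[OF emb_minus_one, of "emb a"] by (simp add: lact_emb)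

lemma minus_one_squared [simp]: "\<mu> * \<mu> = 1"
  by (metis emb_inject emb_minus emb_minus_one neg_neg)

lemma minus_minus [simp]: "\<mu> * (\<mu> * a) = a"
  by (metis minus_one_squared mult.assoc mult_1)

lemma mult_cancel [simp]: "u * a = u * b \<longleftrightarrow> a = b" for u a b :: 't
  using lact_cancel[of u "emb a" "emb b"] by (auto simp: lact_emb)

lemma minus_eq_iff: "\<mu> * a = b \<longleftrightarrow> a = \<mu> * b"
  by auto

text \<open>The quasi-zero \<open>a + (-)a\<close>. By unique negation these are the only sums of two tangible elements that
lie in \<open>\<A>\<^sub>0\<close>.\<close>

definition balance :: "'t \<Rightarrow> 'a" ("_\<^sup>\<circ>" [1000] 1000) where
  "a\<^sup>\<circ> = emb a + emb (\<mu> * a)"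

lemma lact_balance: "u \<cdot>\<^sub>l a\<^sup>\<circ> = (u * a)\<^sup>\<circ>"
  by (simp add: balance_def lact_add lact_emb mult.left_commute)

lemma balance_minus [simp]: "(\<mu> * a)\<^sup>\<circ> = a\<^sup>\<circ>"
  by (simp add: balance_def add.commute)

lemma balance_in_A0: "a\<^sup>\<circ> \<in> A0"
proof -
  have "1\<^sup>\<circ> \<in> A0"
    using one_neg_one by (simp add: balance_def emb_minus_one)
  then show ?thesis
    using A0_lact[of "1\<^sup>\<circ>" a] by (simp add: lact_balance)
qed

lemma sum_in_A0_iff: "emb a + emb b \<in> A0 \<longleftrightarrow> b = \<mu> * a"
proof
  assume "emb a + emb b \<in> A0"
  then have "emb b = neg (emb a)" by (rule neg_unique)
  then show "b = \<mu> * a" by (simp flip: emb_minus)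
next
  assume "b = \<mu> * a"
  then show "emb a + emb b \<in> A0"
    using balance_in_A0[of a] by (simp add: balance_def)
qed

lemma tangible_sum:
  assumes "b \<noteq> \<mu> * a"
  obtains c where "emb c = emb a + emb b"
  using T_add[of a b] assms sum_in_A0_iff[of a b] by (metis UnE rangeE)

text \<open>Strict domination in value. The inequality has to be required because addition may be idempotent.\<close>

definition below :: "'t \<Rightarrow> 't \<Rightarrow> bool" (infix "\<prec>" 50) where
  "a \<prec> b \<longleftrightarrow> a \<noteq> b \<and> emb a + emb b = emb b"

definition level :: "'t \<Rightarrow> 't \<Rightarrow> bool" (infix "\<asymp>" 50) where
  "a \<asymp> b \<longleftrightarrow> \<not> a \<prec> b \<and> \<not> b \<prec> a"

lemma below_irrefl: "\<not> a \<prec> a"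
  by (simp add: below_def)

lemma below_trans:
  assumes "a \<prec> b" and "b \<prec> c"
  shows "a \<prec> c"
proof -
  have ab: "a \<noteq> b" "emb a + emb b = emb b" and bc: "emb b + emb c = emb c"
    using assms by (auto simp: below_def)
  have "emb a + emb c = emb a + emb b + emb c"
    by (simp only: bc add.assoc)
  then have "emb a + emb c = emb c"
    by (simp only: ab bc)
  moreover have "a \<noteq> c"
    using ab bc by (metis add.commute emb_inject)
  ultimately show ?thesis by (simp add: below_def)
qed

lemma below_asym: "a \<prec> b \<Longrightarrow> \<not> b \<prec> a"
  using below_trans below_irrefl by blast

lemma below_mult [simp]: "u * a \<prec> u * b \<longleftrightarrow> a \<prec> b"
proof -
  have "u \<cdot>\<^sub>l (emb a + emb b) = u \<cdot>\<^sub>l emb b \<longleftrightarrow> emb a + emb b = emb b"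
    by (metis lact_cancel)
  then show ?thesis by (simp add: below_def lact_add lact_emb)
qed

lemma level_refl [simp]: "a \<asymp> a"
  by (simp add: level_def below_irrefl)

lemma level_sym: "a \<asymp> b \<Longrightarrow> b \<asymp> a"
  by (simp add: level_def)

lemma level_mult [simp]: "u * a \<asymp> u * b \<longleftrightarrow> a \<asymp> b"
  by (simp add: level_def)

lemma not_below_minus: "\<not> a \<prec> \<mu> * a"
  by (metis below_def emb_notin_A0 sum_in_A0_iff)

lemma not_minus_below: "\<not> \<mu> * a \<prec> a"
  by (metis below_mult minus_minus not_below_minus)

lemma below_minus_right:
  assumes "a \<prec> b"
  shows "a \<prec> \<mu> * b"
proof -
  have ab: "a \<noteq> b" "emb a + emb b = emb b" using assms by (auto simp: below_def)
  have ne: "a \<noteq> \<mu> * b" using assms not_minus_below by blast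
  obtain c where c: "emb c = emb a + emb (\<mu> * b)"
    using tangible_sum[of "\<mu> * b" a] ab(1) by (metis mult_cancel)
  have "emb c + emb b = (emb a + emb b) + emb (\<mu> * b)"
    by (simp add: c ac_simps)
  also have "\<dots> = b\<^sup>\<circ>" by (simp add: ab balance_def)
  finally have "emb c + emb b \<in> A0" by (simp add: balance_in_A0)
  then have "c = \<mu> * b" by (metis minus_minus sum_in_A0_iff)
  then show ?thesis using c ne by (simp add: below_def)
qed

lemma below_balance: "a \<prec> b \<Longrightarrow> emb a + b\<^sup>\<circ> = b\<^sup>\<circ>"
  by (simp add: below_def balance_def flip: add.assoc)

lemma balance_below:
  assumes "a \<prec> b"
  shows "a\<^sup>\<circ> + emb b = emb b"
proof -
  have "\<mu> * a \<prec> b"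
    using below_minus_right[OF assms] by (metis below_mult minus_minus)
  then show ?thesis
    using assms by (simp add: below_def balance_def add.assoc)
qed

text \<open>The dichotomy behind the valuation. If \<open>c = a + b\<close> differs from \<open>b\<close>, then \<open>c + (-)b\<close> is again tangible;
adding \<open>(-)a\<close> to it gives a sum of two quasi-zeros, so unique negation identifies it with \<open>a\<close>.\<close>

lemma below_or_dominates:
  assumes "a \<noteq> b" "a \<noteq> \<mu> * b"
  shows "a \<prec> b \<or> emb a + b\<^sup>\<circ> = emb a"
proof -
  obtain c where c: "emb c = emb a + emb b"
    using tangible_sum[of b a] assms by (metis minus_minus)
  show ?thesis
  proof (cases "c = b")
    case True
    then show ?thesis using c assms by (simp add: below_def)
  next
    case False
    then obtain d where d: "emb d = emb c + emb (\<mu> * b)"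
      using tangible_sum[of "\<mu> * b" c] by (metis mult_cancel)
    have d': "emb d = emb a + b\<^sup>\<circ>"
      by (simp add: d c balance_def ac_simps)
    have "emb d + emb (\<mu> * a) = a\<^sup>\<circ> + b\<^sup>\<circ>"
      by (simp add: d' balance_def ac_simps)
    then have "emb d + emb (\<mu> * a) \<in> A0"
      by (simp add: A0_add balance_in_A0)
    then have "d = a"
      by (metis mult_cancel sum_in_A0_iff)
    then show ?thesis using d' by simp
  qed
qed

text \<open>Two elements of the same value that do not coincide up to sign absorb each other's quasi-zero. Then
the quasi-zeros are equal, so each element absorbs its own quasi-zero, and cancellation transports this to \<open>1\<close>.
Thus a level consists only of \<open>a\<close> and \<open>(-)a\<close>, or it is, as \<open>residue_group_ideal\<close> exploits, a group
with neutral element \<open>a\<^sup>\<circ>\<close> once \<open>a\<^sup>\<circ>\<close> is adjoined.\<close>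

lemma level_cases:
  assumes "a \<asymp> b"
  shows "b = a \<or> b = \<mu> * a \<or> (a\<^sup>\<circ> = b\<^sup>\<circ> \<and> emb 1 + 1\<^sup>\<circ> = emb 1)"
proof (cases "b = a \<or> b = \<mu> * a")
  case False
  then have "a \<noteq> b" "a \<noteq> \<mu> * b" by auto
  have ab: "emb a + b\<^sup>\<circ> = emb a" and ba: "emb b + a\<^sup>\<circ> = emb b"
    using below_or_dominates[of a b] below_or_dominates[of b a] assms False \<open>a \<noteq> b\<close> \<open>a \<noteq> \<mu> * b\<close>
    by (auto simp: level_def)
  have "a\<^sup>\<circ> + b\<^sup>\<circ> = (emb a + b\<^sup>\<circ>) + emb (\<mu> * a)" by (simp add: balance_def ac_simps)
  then have 1: "a\<^sup>\<circ> + b\<^sup>\<circ> = a\<^sup>\<circ>" by (simp only: ab balance_def[of a])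
  have "a\<^sup>\<circ> + b\<^sup>\<circ> = (emb b + a\<^sup>\<circ>) + emb (\<mu> * b)" by (simp add: balance_def ac_simps)
  then have "a\<^sup>\<circ> + b\<^sup>\<circ> = b\<^sup>\<circ>" by (simp only: ba balance_def[of b])
  then have eq: "a\<^sup>\<circ> = b\<^sup>\<circ>" using 1 by simp
  have "a \<cdot>\<^sub>l (emb 1 + 1\<^sup>\<circ>) = a \<cdot>\<^sub>l emb 1"
    using ab eq by (simp add: lact_add lact_emb lact_balance)
  then have "emb 1 + 1\<^sup>\<circ> = emb 1" by (rule lact_cancel)
  then show ?thesis using eq by blast
qed auto

lemma balance_neutral:
  assumes "emb 1 + 1\<^sup>\<circ> = emb 1"
  shows "emb a + a\<^sup>\<circ> = emb a"
proof -
  have "a \<cdot>\<^sub>l (emb 1 + 1\<^sup>\<circ>) = a \<cdot>\<^sub>l emb 1" by (simp add: assms)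
  then show ?thesis by (simp add: lact_add lact_emb lact_balance)
qed

text \<open>This lemma and the next make \<open>\<prec>\<close> a strict weak order, so that \<open>\<asymp>\<close> is an equivalence relation
whose classes are linearly ordered.\<close>

lemma below_level_trans:
  assumes "a \<prec> b" and "b \<asymp> c"
  shows "a \<prec> c"
proof -
  have "emb a + emb c = emb c \<and> a \<noteq> c" if "b\<^sup>\<circ> = c\<^sup>\<circ>" and "emb 1 + 1\<^sup>\<circ> = emb 1"
  proof
    have c: "emb c = emb c + b\<^sup>\<circ>"
      using balance_neutral[OF that(2)] that(1) by simp
    have "emb a + (emb c + b\<^sup>\<circ>) = emb c + b\<^sup>\<circ>"
      using below_balance[OF assms(1)] by (metis add.left_commute)
    then show "emb a + emb c = emb c" using c by simp
    show "a \<noteq> c" using assms by (auto simp: level_def)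
  qed
  then show ?thesis
    using level_cases[OF assms(2)] assms(1) below_minus_right[OF assms(1)]
    by (auto simp: below_def)
qed

lemma level_below_trans:
  assumes "b \<asymp> c" and "b \<prec> d"
  shows "c \<prec> d"
proof -
  have "c \<prec> d" if eq: "b\<^sup>\<circ> = c\<^sup>\<circ>"
  proof -
    have d: "emb d + c\<^sup>\<circ> = emb d"
      using balance_below[OF assms(2)] eq by (simp add: add.commute)
    have "\<not> d \<prec> c"
      using below_level_trans[OF _ level_sym[OF assms(1)]] below_asym assms(2) by blast
    moreover have "\<not> c \<asymp> d"
    proof
      assume "c \<asymp> d"
      then have "b \<prec> c" using below_level_trans[OF assms(2) level_sym] by blast
      then show False using assms(1) by (simp add: level_def)
    qed
    ultimately show ?thesis by (auto simp: level_def)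
  qed
  moreover have "\<mu> * b \<prec> d"
    using below_minus_right[OF assms(2)] by (metis below_mult minus_minus)
  ultimately show ?thesis
    using level_cases[OF assms(1)] assms(2) by auto
qed

lemma level_trans:
  assumes "a \<asymp> b" and "b \<asymp> c"
  shows "a \<asymp> c"
  using below_level_trans level_below_trans assms level_sym unfolding level_def by metis

end

section \<open>Ideals with leading coefficients\<close>

definition (in negated_metatangible_pair) lower :: "'t \<Rightarrow> 't formal_sum \<Rightarrow> bool" where
  "lower t x \<longleftrightarrow> (\<forall>w\<in>#terms x. w \<prec> t)"

text \<open>The ideal \<open>P\<close> consists of the formal sums that are regarded as zero. Modulo \<open>P\<close> the formal sums behave
like a ring graded by the levels: \<open>merge\<close> says that a homogeneous sum is zero or a multiple \<open>k * t\<close> of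
one tangible element with \<open>k \<in> K\<close>, and \<open>leading_balance\<close> relates zero in this ring to \<open>\<A>\<^sub>0\<close>: if the part of highest
level of an element of \<open>P\<close> is a sum of such multiples, then their tangible factors balance in the pair.
The bound \<open>k' \<le> Suc k\<close> keeps the number of terms under control in the induction of \<open>exists_leading\<close>.\<close>

locale leading_coefficient_ideal = negated_metatangible_pair lact ract emb A0 neg
  for lact :: "'t::comm_monoid_mult \<Rightarrow> 'a::comm_monoid_add \<Rightarrow> 'a" (infixr "\<cdot>\<^sub>l" 75)
    and ract :: "'a \<Rightarrow> 't \<Rightarrow> 'a" (infixl "\<cdot>\<^sub>r" 75)
    and emb :: "'t \<Rightarrow> 'a" and A0 :: "'a set" and neg :: "'a \<Rightarrow> 'a" +
  fixes P :: "'t formal_sum set" and K :: "nat set"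
  assumes P_zero: "0 \<in> P"
    and P_add: "x \<in> P \<Longrightarrow> y \<in> P \<Longrightarrow> x + y \<in> P"
    and P_cancel: "x \<in> P \<Longrightarrow> x + y \<in> P \<Longrightarrow> y \<in> P"
    and P_monomial: "x \<in> P \<Longrightarrow> monomial 1 u * x \<in> P"
    and P_opposite: "1 + monomial 1 \<mu> \<in> P"
    and K_one: "1 \<in> K"
    and K_mult: "k \<in> K \<Longrightarrow> l \<in> K \<Longrightarrow> k * l \<in> K"
    and merge: "k \<in> K \<Longrightarrow> t \<asymp> u \<Longrightarrow> monomial k t + monomial 1 u \<in> P \<or>
      (\<exists>k'\<in>K. \<exists>t'. k' \<le> Suc k \<and> t' \<asymp> t \<and>
        monomial k t + monomial 1 u + monomial 1 \<mu> * monomial k' t' \<in> P)"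
    and leading_balance: "finite (J :: nat set) \<Longrightarrow> J \<noteq> {} \<Longrightarrow>
      (\<And>i. i \<in> J \<Longrightarrow> s i \<asymp> t \<and> c i \<in> K) \<Longrightarrow>
      lower t y \<Longrightarrow> (\<Sum>i\<in>J. monomial (c i) (s i)) + y \<in> P \<Longrightarrow> (\<Sum>i\<in>J. emb (s i)) \<in> A0"
begin

text \<open>This stands for \<open>-1\<close>, which natural coefficients do not provide.\<close>

definition opp :: "'t formal_sum" ("\<eta>") where
  "\<eta> = monomial 1 \<mu>"

definition cong (infix "\<simeq>" 50) where
  "x \<simeq> y \<longleftrightarrow> x + \<eta> * y \<in> P"

lemma opp_squared [simp]: "\<eta> * \<eta> = 1"
  by (simp add: opp_def monomial_mult)

lemma opp_opp [simp]: "\<eta> * (\<eta> * x) = x"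
  by (metis opp_squared mult.assoc mult_1)

lemma P_ideal: "x \<in> P \<Longrightarrow> y * x \<in> P"
proof (induction y rule: formal_sum_induct)
  case (add y u)
  then show ?case using P_monomial by (simp add: distrib_right P_add)
qed (simp add: P_zero)

lemma P_ideal': "x \<in> P \<Longrightarrow> x * y \<in> P"
  using P_ideal[of x y] by (simp add: mult.commute)

lemma opposite_in_P: "x + \<eta> * x \<in> P"
  using P_ideal'[OF P_opposite, of x] by (simp add: opp_def distrib_right)

lemma P_sum: "(\<And>i. i \<in> J \<Longrightarrow> f i \<in> P) \<Longrightarrow> (\<Sum>i\<in>J. f i) \<in> P"
  by (induction J rule: infinite_finite_induct) (auto simp: P_zero P_add)

lemma cong_refl [simp]: "x \<simeq> x"
  by (simp add: cong_def opposite_in_P)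

lemma cong_trans:
  assumes "x \<simeq> y" "y \<simeq> z"
  shows "x \<simeq> z"
proof -
  have "(y + \<eta> * y) + (x + \<eta> * z) = (x + \<eta> * y) + (y + \<eta> * z)"
    by (simp add: ac_simps)
  then have "(y + \<eta> * y) + (x + \<eta> * z) \<in> P"
    using assms P_add by (simp add: cong_def)
  then show ?thesis
    using P_cancel opposite_in_P unfolding cong_def by blast
qed

lemma cong_add: "x \<simeq> y \<Longrightarrow> x' \<simeq> y' \<Longrightarrow> x + x' \<simeq> y + y'"
  unfolding cong_def using P_add[of "x + \<eta> * y" "x' + \<eta> * y'"]
  by (simp add: distrib_left add.assoc add.left_commute)

lemma cong_sum: "(\<And>i. i \<in> J \<Longrightarrow> f i \<simeq> g i) \<Longrightarrow> (\<Sum>i\<in>J. f i) \<simeq> (\<Sum>i\<in>J. g i)"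
  by (induction J rule: infinite_finite_induct) (auto simp: cong_add)

lemma cong_mult_right: "x \<simeq> y \<Longrightarrow> x * z \<simeq> y * z"
  unfolding cong_def using P_ideal'[of "x + \<eta> * y" z] by (simp add: distrib_right mult.assoc)

lemma cong_in_P:
  assumes "x \<simeq> y" and "x \<in> P"
  shows "y \<in> P"
proof -
  have "\<eta> * y \<in> P"
    using assms P_cancel unfolding cong_def by blast
  then have "\<eta> * (\<eta> * y) \<in> P" by (rule P_ideal)
  then show ?thesis by simp
qed

lemma in_P_cong:
  assumes "x \<simeq> y" and "y \<in> P"
  shows "x \<in> P"
proof -
  have "\<eta> * y + x \<in> P"
    using assms(1) by (simp add: cong_def add.commute)
  then show ?thesis
    using P_cancel P_ideal assms(2) by blast
qed

lemma cong_zero: "x \<in> P \<Longrightarrow> x \<simeq> 0"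
  by (simp add: cong_def)

lemma lower_zero [simp]: "lower t 0"
  by (simp add: lower_def)

lemma lower_add: "lower t x \<Longrightarrow> lower t y \<Longrightarrow> lower t (x + y)"
  by (auto simp: lower_def)

lemma lower_level: "lower t x \<Longrightarrow> t \<asymp> u \<Longrightarrow> lower u x"
  using below_level_trans by (auto simp: lower_def)

lemma lower_below: "lower t x \<Longrightarrow> t \<prec> u \<Longrightarrow> lower u x"
  using below_trans by (auto simp: lower_def)

lemma lower_monomial: "t \<prec> u \<Longrightarrow> lower u (monomial k t)"
  by (auto simp: lower_def)

lemma below_mult_both: "a \<prec> t \<Longrightarrow> b \<prec> u \<Longrightarrow> a * b \<prec> t * u"
  using below_trans[of "a * b" "a * u" "t * u"] below_mult[of a b u] below_mult[of u a t]
  by (simp add: mult.commute)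

lemma lower_mult_monomial:
  assumes "lower t x"
  shows "lower (t * u) (x * monomial k u)"
  unfolding lower_def
proof
  fix w assume "w \<in># terms (x * monomial k u)"
  then obtain a where "a \<in># terms x" and w: "w = u * a"
    unfolding in_terms_times by (auto simp: mult.commute split: if_splits)
  then have "a \<prec> t" using assms by (simp add: lower_def)
  then show "w \<prec> t * u"
    unfolding w mult.commute[of t u] by simp
qed

lemma lower_mult:
  assumes "lower t x" and "lower u y"
  shows "lower (t * u) (x * y)"
  using assms below_mult_both unfolding lower_def by (metis in_terms_times)

lemma lower_sum: "(\<And>i. i \<in> J \<Longrightarrow> lower t (f i)) \<Longrightarrow> lower t (\<Sum>i\<in>J. f i)"
  by (induction J rule: infinite_finite_induct) (auto simp: lower_add)

definition leading :: "'t formal_sum \<Rightarrow> nat \<Rightarrow> 't \<Rightarrow> 't formal_sum \<Rightarrow> bool" where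
  "leading x k t y \<longleftrightarrow> k \<in> K \<and> lower t y \<and> x \<simeq> monomial k t + y"

text \<open>The case of one summand in \<open>leading_balance\<close>: a tangible element does not lie in \<open>\<A>\<^sub>0\<close>.\<close>

lemma leading_notin_P:
  assumes "leading x k t y"
  shows "x \<notin> P"
proof
  assume "x \<in> P"
  then have "(\<Sum>i\<in>{0::nat}. monomial k t) + y \<in> P"
    using assms cong_in_P by (auto simp: leading_def)
  then have "(\<Sum>i\<in>{0::nat}. emb t) \<in> A0"
    using assms by (intro leading_balance[where t = t and y = y and c = "\<lambda>_. k"]) (auto simp: leading_def)
  then show False using emb_notin_A0 by simp
qed

text \<open>Split off one term \<open>u\<close> and compare it with the leading term \<open>k * t\<close> of the rest. The induction is on the number of terms
because a cancellation at the top level leaves only the lower part, whose own leading term is then needed.\<close>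

lemma exists_leading:
  assumes "x \<notin> P"
  shows "\<exists>k t y. leading x k t y \<and> k + size (terms y) \<le> size (terms x)"
  using assms
proof (induction "size (terms x)" arbitrary: x rule: less_induct)
  case less
  then have "terms x \<noteq> {#}"
    using P_zero by (metis formal_sum_eqI terms_zero)
  then obtain u X where "terms x = add_mset u X"
    by (metis multiset_cases)
  then have x: "x = formal_sum X + monomial 1 u"
    by (intro formal_sum_eqI) (simp add: formal_sum_inverse)
  define x0 where "x0 = formal_sum X"
  have size: "size (terms x) = Suc (size (terms x0))"
    by (simp add: x x0_def)
  show ?case
  proof (cases "x0 \<in> P")
    case True
    then have "x \<simeq> 0 + monomial 1 u"
      unfolding x x0_def[symmetric] by (intro cong_add cong_zero) auto
    then have "leading x 1 u 0" by (simp add: leading_def K_one[simplified])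
    moreover have "1 + size (terms 0) \<le> size (terms x)" using size by simp
    ultimately show ?thesis by blast
  next
    case False
    then obtain k t y where lead: "leading x0 k t y" and le: "k + size (terms y) \<le> size (terms x0)"
      using less.hyps[of x0] size by auto
    have x': "x \<simeq> monomial k t + y + monomial 1 u"
      unfolding x x0_def[symmetric] using lead by (intro cong_add) (auto simp: leading_def)
    consider "u \<prec> t" | "t \<prec> u" | "t \<asymp> u" by (auto simp: level_def)
    then show ?thesis
    proof cases
      case 1
      then have "leading x k t (y + monomial 1 u)"
        using lead x' by (auto simp: leading_def add.assoc intro: lower_add lower_monomial)
      then show ?thesis using le size by (intro exI conjI) auto
    next
      case 2
      have "leading x 1 u (monomial k t + y)"
        using lead x' 2 K_one[simplified]
        by (auto simp: leading_def add.commute[of "monomial (Suc 0) u"]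
            intro: lower_add lower_monomial lower_below)
      then show ?thesis using le size by (intro exI conjI) auto
    next
      case 3
      have split: "monomial k t + y + monomial 1 u = (monomial k t + monomial 1 u) + y"
        by (simp add: ac_simps)
      show ?thesis
      proof (cases "monomial k t + monomial 1 u \<in> P")
        case True
        then have "x \<simeq> 0 + y"
          using cong_trans[OF x', unfolded split] cong_add cong_zero cong_refl by blast
        then have xy: "x \<simeq> y" by simp
        then have "y \<notin> P" using less.prems in_P_cong by blast
        moreover have "size (terms y) < size (terms x)" using le size by linarith
        ultimately obtain k' t' y' where "leading y k' t' y'" "k' + size (terms y') \<le> size (terms y)"
          using less.hyps by blast
        moreover have "leading x k' t' y'"
          using \<open>leading y k' t' y'\<close> cong_trans[OF xy] by (auto simp: leading_def)
        ultimately show ?thesis using le size by (meson le_trans less_imp_le \<open>size (terms y) < size (terms x)\<close>)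
      next
        case False
        then obtain k' t' where k': "k' \<in> K" "k' \<le> Suc k" "t' \<asymp> t"
          and c: "monomial k t + monomial 1 u \<simeq> monomial k' t'"
          using merge[OF _ 3, of k] lead by (auto simp: leading_def cong_def opp_def)
        have "x \<simeq> monomial k' t' + y"
          using cong_trans[OF x', unfolded split] cong_add[OF c cong_refl] by blast
        then have "leading x k' t' y"
          using k' lead level_sym lower_level by (auto simp: leading_def)
        then show ?thesis using k' le size by (intro exI conjI) auto
      qed
    qed
  qed
qed

lemma leading_mult:
  assumes "leading x k t a" and "leading y l u b"
  shows "\<exists>c. leading (x * y) (k * l) (t * u) c"
proof -
  let ?x = "monomial k t + a" and ?y = "monomial l u + b"
  have "x * y \<simeq> ?x * y"
    using assms by (intro cong_mult_right) (auto simp: leading_def)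
  moreover have "?x * y \<simeq> ?x * ?y"
    using assms cong_mult_right[of y ?y ?x] by (auto simp: leading_def mult.commute)
  ultimately have 1: "x * y \<simeq> ?x * ?y" by (rule cong_trans)
  define c where "c = a * monomial l u + (b * monomial k t + a * b)"
  have 2: "?x * ?y = monomial (k * l) (t * u) + c"
    unfolding c_def by (simp add: distrib_left distrib_right monomial_mult[symmetric] ac_simps)
  have "lower (t * u) (b * monomial k t)"
    using lower_mult_monomial[of u b t k] assms by (simp add: leading_def mult.commute)
  then have "lower (t * u) c"
    using assms unfolding c_def by (intro lower_add) (auto simp: leading_def lower_mult_monomial lower_mult)
  then have "leading (x * y) (k * l) (t * u) c"
    using 1 assms unfolding 2 by (auto simp: leading_def K_mult)
  then show ?thesis by blast
qed

text \<open>As for polynomials over a domain, leading terms multiply.\<close>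

lemma P_prime:
  assumes "x * y \<in> P"
  shows "x \<in> P \<or> y \<in> P"
proof (rule ccontr)
  assume "\<not> (x \<in> P \<or> y \<in> P)"
  then obtain k t a l u b where "leading x k t a" "leading y l u b"
    using exists_leading[of x] exists_leading[of y] by auto
  then show False
    using leading_mult leading_notin_P assms by blast
qed

end

context leading_coefficient_ideal
begin

lemma leading_monomial: "leading (monomial 1 u) 1 u 0"
  using K_one by (simp add: leading_def)

lemma sum_absorbs_lower:
  assumes "finite J" and "m \<in> J" and "finite L" and "\<And>i. i \<in> L \<Longrightarrow> s i \<prec> s m"
  shows "(\<Sum>i\<in>L. emb (s i)) + (\<Sum>i\<in>J. emb (s i)) = (\<Sum>i\<in>J. emb (s i))"
  using assms(3,4)
proof (induction L)
  case (insert l L)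
  have "emb (s l) + emb (s m) = emb (s m)"
    using insert.prems[of l] by (simp add: below_def)
  then have "emb (s l) + (\<Sum>i\<in>J. emb (s i)) = (\<Sum>i\<in>J. emb (s i))"
    using assms(1,2) by (simp add: sum.remove flip: add.assoc)
  then show ?case using insert by (simp add: add.assoc)
qed simp

text \<open>Only the summands whose leading terms have the highest level \<open>s m\<close> matter. Everything else is lower, both in the formal sum, where
\<open>leading_balance\<close> discards it, and in \<open>\<A>\<close>, where \<open>emb (s m)\<close> absorbs it.\<close>

lemma leading_terms_balance:
  fixes J :: "nat set"
  assumes "finite J" and lead: "\<And>i. i \<in> J \<Longrightarrow> leading (q i) (k i) (s i) (b i)"
    and sum: "(\<Sum>i\<in>J. q i) \<in> P"
  shows "(\<Sum>i\<in>J. emb (s i)) \<in> A0"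
proof (cases "J = {}")
  case False
  obtain m where m: "m \<in> J" and max: "\<And>i. i \<in> J \<Longrightarrow> \<not> s m \<prec> s i"
  proof -
    have asymp: "asymp_on J (\<lambda>i j. s i \<prec> s j)"
      using below_asym by (rule asymp_onI)
    have transp: "transp_on J (\<lambda>i j. s i \<prec> s j)"
      using below_trans by (rule transp_onI)
    obtain m where m: "m \<in> J" "\<forall>i\<in>J. i \<noteq> m \<longrightarrow> \<not> s m \<prec> s i"
      using Finite_Set.bex_max_element[OF \<open>finite J\<close> asymp transp False] by blast
    have "\<not> s m \<prec> s i" if "i \<in> J" for i
      using m(2) that below_irrefl by (cases "i = m") auto
    then show ?thesis using that m(1) by blast
  qed
  define J' where "J' = {i\<in>J. s i \<asymp> s m}"
  have J': "finite J'" "J' \<subseteq> J" "m \<in> J'" and rest: "\<And>i. i \<in> J - J' \<Longrightarrow> s i \<prec> s m"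
    using \<open>finite J\<close> m max by (auto simp: J'_def level_def below_irrefl)
  \<comment> \<open>All terms of the combination below level \<open>s m\<close>.\<close>
  define y where "y = (\<Sum>i\<in>J - J'. monomial (k i) (s i)) + (\<Sum>i\<in>J. b i)"
  have "lower (s m) y"
    unfolding y_def
  proof (intro lower_add lower_sum)
    fix i assume "i \<in> J - J'"
    then show "lower (s m) (monomial (k i) (s i))" by (intro lower_monomial rest)
  next
    fix i assume "i \<in> J"
    then have "lower (s i) (b i)" using lead by (simp add: leading_def)
    moreover have "s i \<asymp> s m \<or> s i \<prec> s m"
      using rest[of i] \<open>i \<in> J\<close> by (auto simp: J'_def)
    ultimately show "lower (s m) (b i)"
      using lower_level lower_below by blast
  qed
  moreover have "(\<Sum>i\<in>J'. monomial (k i) (s i)) + y \<in> P"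
  proof -
    have "(\<Sum>i\<in>J. q i) \<simeq> (\<Sum>i\<in>J. monomial (k i) (s i) + b i)"
      using lead by (intro cong_sum) (simp add: leading_def)
    also have "(\<Sum>i\<in>J. monomial (k i) (s i) + b i) = (\<Sum>i\<in>J'. monomial (k i) (s i)) + y"
      unfolding y_def sum.distrib sum.subset_diff[OF J'(2) \<open>finite J\<close>, of "\<lambda>i. monomial (k i) (s i)"]
      by (simp only: ac_simps)
    finally show ?thesis using sum cong_in_P by blast
  qed
  ultimately have "(\<Sum>i\<in>J'. emb (s i)) \<in> A0"
    using J' lead by (intro leading_balance[where t = "s m" and c = k and y = y])
      (auto simp: J'_def leading_def)
  moreover have "(\<Sum>i\<in>J. emb (s i)) = (\<Sum>i\<in>J'. emb (s i))"
    using sum_absorbs_lower[of J' m "J - J'" s, OF J'(1,3) finite_Diff[OF \<open>finite J\<close>] rest]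
    by (simp add: sum.subset_diff[OF J'(2) \<open>finite J\<close>])
  ultimately show ?thesis by simp
qed (simp add: A0_zero)

text \<open>Lift the entries to monomials, find coefficients in the formal sums by elimination modulo \<open>P\<close>, and replace each
coefficient outside \<open>P\<close> by its leading tangible element. Rows whose coefficient lies in \<open>P\<close> are dropped.\<close>

lemma tangible_rows_dependent:
  fixes I :: "nat set" and y :: "nat \<Rightarrow> nat \<Rightarrow> 'a"
  assumes "finite I" and "n < card I"
    and tangible: "\<And>i j. y i j \<in> insert 0 (range emb)"
  shows "\<exists>I' a. I' \<subseteq> I \<and> I' \<noteq> {} \<and> (\<forall>j<n. (\<Sum>i\<in>I'. a i \<cdot>\<^sub>l y i j) \<in> A0)"
proof -
  define u where "u i j = inv_into UNIV emb (y i j)" for i j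
  have u: "emb (u i j) = y i j" if "y i j \<noteq> 0" for i j
    using tangible[of i j] that by (auto simp: u_def f_inv_into_f)
  define v where "v i j = (if y i j = 0 then 0 else monomial 1 (u i j))" for i j
  have one: "1 \<notin> P"
    using leading_notin_P[OF leading_monomial[of 1]] by simp
  have opp: "1 + \<eta> \<in> P"
    using opposite_in_P[of 1] by simp
  have "\<exists>p. (\<exists>i\<in>I. p i \<notin> P) \<and> (\<forall>j<n. (\<Sum>i\<in>I. p i * v i j) \<in> P)"
    by (rule dependent_modulo_prime_ideal[where P = P and \<eta> = \<eta>])
      (fact P_zero P_add P_ideal P_prime one opp assms(1,2))+
  then obtain p where p: "\<exists>i\<in>I. p i \<notin> P" "\<forall>j<n. (\<Sum>i\<in>I. p i * v i j) \<in> P"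
    by blast
  define I' where "I' = {i\<in>I. p i \<notin> P}"
  have "\<forall>i\<in>I'. \<exists>k t z. leading (p i) k t z"
    using exists_leading unfolding I'_def by blast
  then obtain k t z where lead: "\<And>i. i \<in> I' \<Longrightarrow> leading (p i) (k i) (t i) (z i)"
    by metis
  have "(\<Sum>i\<in>I'. t i \<cdot>\<^sub>l y i j) \<in> A0" if "j < n" for j
  proof -
    define J where "J = {i\<in>I'. y i j \<noteq> 0}"
    have fin: "finite I'" "finite J" using assms(1) by (auto simp: I'_def J_def)
    define q where "q i = p i * monomial 1 (u i j)" for i
    have "\<forall>i\<in>J. \<exists>b. leading (q i) (k i * 1) (t i * u i j) b"
    proof
      fix i assume "i \<in> J"
      then have "leading (p i) (k i) (t i) (z i)" by (intro lead) (simp add: J_def)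
      then show "\<exists>b. leading (q i) (k i * 1) (t i * u i j) b"
        unfolding q_def using leading_monomial by (rule leading_mult)
    qed
    then obtain b where b: "\<And>i. i \<in> J \<Longrightarrow> leading (q i) (k i * 1) (t i * u i j) (b i)"
      by metis
    have "(\<Sum>i\<in>I. p i * v i j) = (\<Sum>i\<in>I - I'. p i * v i j) + (\<Sum>i\<in>I'. p i * v i j)"
      using assms(1) by (intro sum.subset_diff) (auto simp: I'_def)
    moreover have "(\<Sum>i\<in>I - I'. p i * v i j) \<in> P"
      by (intro P_sum P_ideal') (auto simp: I'_def)
    ultimately have "(\<Sum>i\<in>I'. p i * v i j) \<in> P"
      using p(2) that P_cancel by metis
    moreover have "(\<Sum>i\<in>I'. p i * v i j) = (\<Sum>i\<in>J. q i)"
      using fin by (intro sum.mono_neutral_cong_right) (auto simp: J_def v_def q_def)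
    ultimately have q: "(\<Sum>i\<in>J. q i) \<in> P" by simp
    have "(\<Sum>i\<in>J. emb (t i * u i j)) \<in> A0"
      by (rule leading_terms_balance[where q = q and b = b and k = "\<lambda>i. k i * 1"])
        (fact fin(2) b q)+
    moreover have "(\<Sum>i\<in>I'. t i \<cdot>\<^sub>l y i j) = (\<Sum>i\<in>J. emb (t i * u i j))"
      using fin by (intro sum.mono_neutral_cong_right)
        (auto simp: J_def lact_zero u simp flip: lact_emb)
    ultimately show ?thesis by simp
  qed
  moreover have "I' \<subseteq> I" "I' \<noteq> {}" using p(1) by (auto simp: I'_def)
  ultimately show ?thesis by blast
qed

end

section \<open>The three kinds of residue structure\<close>

context negated_metatangible_pair
begin

definition level_sum :: "'t \<Rightarrow> 't formal_sum \<Rightarrow> 'a" where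
  "level_sum s x = (\<Sum>w\<in>#filter_mset (\<lambda>w. s \<asymp> w) (terms x). emb w)"

lemma level_sum_zero [simp]: "level_sum s 0 = 0"
  by (simp add: level_sum_def)

lemma level_sum_add [simp]: "level_sum s (x + y) = level_sum s x + level_sum s y"
  by (simp add: level_sum_def)

lemma level_sum_monomial: "level_sum s (monomial 1 t) = (if s \<asymp> t then emb t else 0)"
  by (simp add: level_sum_def)

lemma level_sum_sum: "level_sum s (\<Sum>i\<in>J. f i) = (\<Sum>i\<in>J. level_sum s (f i))"
  by (induction J rule: infinite_finite_induct) auto

lemma lact_sum_mset: "u \<cdot>\<^sub>l (\<Sum>w\<in>#X. emb w) = (\<Sum>w\<in>#X. emb (u * w))"
  by (induction X) (simp_all add: lact_zero lact_add lact_emb)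

lemma level_sum_shift: "level_sum (u * s) (monomial 1 u * x) = u \<cdot>\<^sub>l level_sum s x"
  by (simp add: level_sum_def filter_mset_image_mset lact_sum_mset comp_def multiset.map_comp)

lemma level_sum_level:
  assumes "s \<asymp> s'"
  shows "level_sum s x = level_sum s' x"
proof -
  have "s \<asymp> w \<longleftrightarrow> s' \<asymp> w" for w
    using assms level_sym level_trans by blast
  then show ?thesis by (simp only: level_sum_def)
qed

lemma level_sum_lower: "lower t y \<Longrightarrow> level_sum t y = 0"
proof -
  assume "lower t y"
  then have eq: "filter_mset (\<lambda>w. t \<asymp> w) (terms y) = filter_mset (\<lambda>_. False) (terms y)"
    by (intro filter_mset_cong refl) (auto simp: lower_def level_def)
  show ?thesis unfolding level_sum_def eq by simp
qed

text \<open>If \<open>1\<close> absorbs its quasi-zero, then each level together with its quasi-zero \<open>s\<^sup>\<circ>\<close> is an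
abelian group under the addition of \<open>\<A>\<close>, with neutral element \<open>s\<^sup>\<circ>\<close>. A formal sum is zero if each of its homogeneous
parts has value \<open>s\<^sup>\<circ>\<close>; this is the situation of a field graded by an ordered group.\<close>

lemma residue_group_ideal:
  assumes unit: "emb 1 + 1\<^sup>\<circ> = emb 1"
  shows "leading_coefficient_ideal lact ract emb A0 neg {x. \<forall>s. s\<^sup>\<circ> + level_sum s x = s\<^sup>\<circ>} {1}"
    (is "leading_coefficient_ideal _ _ _ _ _ ?P _")
proof -
  note dom = balance_neutral[OF unit]
  have dom2: "a\<^sup>\<circ> + a\<^sup>\<circ> = a\<^sup>\<circ>" for a
  proof -
    have "a\<^sup>\<circ> + a\<^sup>\<circ> = emb (\<mu> * a) + (emb a + a\<^sup>\<circ>)"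
      by (simp add: balance_def ac_simps)
    then show ?thesis by (simp only: dom) (simp add: balance_def add.commute)
  qed
  have level_iff: "a \<asymp> b \<longleftrightarrow> a\<^sup>\<circ> = b\<^sup>\<circ>" for a b
  proof
    assume "a \<asymp> b"
    then show "a\<^sup>\<circ> = b\<^sup>\<circ>" using level_cases[of a b] by auto
  next
    have *: "\<not> a \<prec> b" if "a\<^sup>\<circ> = b\<^sup>\<circ>" for a b
      using below_balance[of a b] dom[of a] that balance_in_A0[of b] emb_notin_A0[of a] by auto
    assume "a\<^sup>\<circ> = b\<^sup>\<circ>"
    then show "a \<asymp> b" using *[of a b] *[of b a] by (simp add: level_def)
  qed
  have opp: "monomial 1 t + monomial 1 (\<mu> * t) \<in> ?P" for t
  proof -
    have "s\<^sup>\<circ> + (emb t + emb (\<mu> * t)) = s\<^sup>\<circ>" if "s \<asymp> t" for s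
      using that dom2[of t] level_iff by (simp add: balance_def)
    moreover have "s \<asymp> \<mu> * t \<longleftrightarrow> s \<asymp> t" for s
      using level_iff by simp
    ultimately show ?thesis by (auto simp: level_sum_monomial simp del: One_nat_def)
  qed
  show ?thesis
  proof unfold_locales
    show "0 \<in> ?P" by simp
  next
    fix x y assume "x \<in> ?P" "y \<in> ?P"
    then show "x + y \<in> ?P" by (simp flip: add.assoc)
  next
    fix x y assume "x \<in> ?P" "x + y \<in> ?P"
    then show "y \<in> ?P" by (simp flip: add.assoc)
  next
    fix x u assume x: "x \<in> ?P"
    have "s\<^sup>\<circ> + level_sum s (monomial 1 u * x) = s\<^sup>\<circ>" for s
    proof (cases "\<exists>v. s \<asymp> u * v")
      case True
      then obtain v where v: "s \<asymp> u * v" by blast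
      have "s\<^sup>\<circ> + level_sum s (monomial 1 u * x) = u \<cdot>\<^sub>l (v\<^sup>\<circ> + level_sum v x)"
        using v by (simp only: level_sum_level[OF v] level_sum_shift lact_add lact_balance level_iff)
      also have "\<dots> = s\<^sup>\<circ>" using x v level_iff by (simp add: lact_balance)
      finally show ?thesis .
    next
      case False
      then show ?thesis
        by (simp add: level_sum_def filter_mset_image_mset)
    qed
    then show "monomial 1 u * x \<in> ?P" by simp
  next
    show "1 + monomial 1 \<mu> \<in> ?P" using opp[of 1] by simp
  next
    fix k t u assume k: "k \<in> {1::nat}" and tu: "t \<asymp> u"
    show "monomial k t + monomial 1 u \<in> ?P \<or>
      (\<exists>k'\<in>{1}. \<exists>t'. k' \<le> Suc k \<and> t' \<asymp> t \<and>
        monomial k t + monomial 1 u + monomial 1 \<mu> * monomial k' t' \<in> ?P)"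
    proof (cases "u = \<mu> * t")
      case True
      then show ?thesis using opp[of t] k by simp
    next
      case False
      then obtain c where c: "emb c = emb t + emb u" by (rule tangible_sum)
      have "emb (\<mu> * c) = emb (\<mu> * t) + emb (\<mu> * u)"
        by (simp only: emb_minus c neg_add)
      \<comment> \<open>The sum does not drop to a lower level.\<close>
      then have "c\<^sup>\<circ> = t\<^sup>\<circ> + u\<^sup>\<circ>"
        by (simp add: balance_def c add_ac)
      then have ct: "c \<asymp> t" and cu: "u \<asymp> c"
        using tu dom2 level_iff by auto
      have "s \<asymp> t \<longleftrightarrow> s \<asymp> c" "s \<asymp> u \<longleftrightarrow> s \<asymp> c" "s \<asymp> \<mu> * c \<longleftrightarrow> s \<asymp> c" for s
        using ct cu level_iff by auto
      then have "level_sum s (monomial 1 t + monomial 1 u + monomial 1 (\<mu> * c)) =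
        level_sum s (monomial 1 c + monomial 1 (\<mu> * c))" for s
        by (simp add: level_sum_monomial c del: One_nat_def)
      then have "monomial 1 t + monomial 1 u + monomial 1 (\<mu> * c) \<in> ?P"
        using opp[of c] by simp
      moreover have "monomial 1 \<mu> * monomial 1 c = monomial 1 (\<mu> * c)"
        by (simp add: monomial_mult)
      ultimately show ?thesis using k ct by auto
    qed
  next
    fix J :: "nat set" and s t c y
    assume J: "finite J" "J \<noteq> {}" and sc: "\<And>i. i \<in> J \<Longrightarrow> s i \<asymp> t \<and> c i \<in> {1::nat}"
      and y: "lower t y" and P: "(\<Sum>i\<in>J. monomial (c i) (s i)) + y \<in> ?P"
    have "level_sum t (\<Sum>i\<in>J. monomial (c i) (s i)) = (\<Sum>i\<in>J. emb (s i))"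
      unfolding level_sum_sum using sc level_sym
      by (intro sum.cong) (auto simp: level_sum_monomial[unfolded One_nat_def])
    moreover have "t\<^sup>\<circ> + level_sum t ((\<Sum>i\<in>J. monomial (c i) (s i)) + y) = t\<^sup>\<circ>"
      using P by blast
    ultimately have "t\<^sup>\<circ> + (\<Sum>i\<in>J. emb (s i)) = t\<^sup>\<circ>"
      using level_sum_lower[OF y] by simp
    moreover have "t\<^sup>\<circ> + (\<Sum>i\<in>J. emb (s i)) = (\<Sum>i\<in>J. emb (s i))"
    proof -
      obtain m where m: "m \<in> J" using J by blast
      have "t\<^sup>\<circ> + emb (s m) = emb (s m)"
        using dom[of "s m"] sc[OF m] level_iff by (simp add: add.commute)
      then show ?thesis using m J(1) by (simp add: sum.remove flip: add.assoc)
    qed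
    ultimately show "(\<Sum>i\<in>J. emb (s i)) \<in> A0"
      using balance_in_A0[of t] by simp
  qed (simp_all)
qed

lemma count_shift: "count (image_mset ((*) u) X) (u * v) = count X v" for u v :: 't
  by (induction X) auto

lemma count_shift_outside:
  "(\<And>v. s \<noteq> u * v) \<Longrightarrow> count (image_mset ((*) u) X) s = 0" for s u :: 't
  by (auto simp: count_eq_zero_iff)

lemma count_terms_lower: "lower t y \<Longrightarrow> count (terms y) t = 0"
  using below_irrefl by (auto simp: lower_def count_eq_zero_iff)

lemma count_sum_monomials:
  "count (terms (\<Sum>i\<in>J. monomial (c i) (s i))) t = (\<Sum>i\<in>J. if s i = t then c i else 0)"
  by (induction J rule: infinite_finite_induct) auto

text \<open>Here each level is a single element \<open>t\<close> and \<open>t + t\<close> is a quasi-zero. Whether an odd multiple of \<open>t\<close> lies in \<open>\<A>\<^sub>0\<close>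
varies from pair to pair (in the supertropical case \<open>t + t + t\<close> does), but even multiples always do, so counting modulo \<open>2\<close>
is safe.\<close>

lemma parity_ideal:
  assumes ne: "emb 1 + 1\<^sup>\<circ> \<noteq> emb 1" and mu: "\<mu> = 1"
  shows "leading_coefficient_ideal lact ract emb A0 neg {x. \<forall>s. even (count (terms x) s)} {1}"
    (is "leading_coefficient_ideal _ _ _ _ _ ?P _")
proof -
  have level_eq: "a \<asymp> b \<Longrightarrow> a = b" for a b
    using level_cases[of a b] ne mu by auto
  show ?thesis
  proof unfold_locales
    fix x u assume x: "x \<in> ?P"
    have "even (count (image_mset ((*) u) (terms x)) s)" for s
      using x count_shift count_shift_outside by (cases "\<exists>v. s = u * v") fastforce+
    then show "monomial 1 u * x \<in> ?P" by simp
  next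
    show "1 + monomial 1 \<mu> \<in> ?P"
      by (simp add: mu flip: monomial_one)
  next
    fix k t u assume "k \<in> {1::nat}" and "t \<asymp> u"
    then show "monomial k t + monomial 1 u \<in> ?P \<or>
      (\<exists>k'\<in>{1}. \<exists>t'. k' \<le> Suc k \<and> t' \<asymp> t \<and>
        monomial k t + monomial 1 u + monomial 1 \<mu> * monomial k' t' \<in> ?P)"
      using level_eq by auto
  next
    fix J :: "nat set" and s t c y
    assume J: "finite J" "J \<noteq> {}" and sc: "\<And>i. i \<in> J \<Longrightarrow> s i \<asymp> t \<and> c i \<in> {1::nat}"
      and y: "lower t y" and P: "(\<Sum>i\<in>J. monomial (c i) (s i)) + y \<in> ?P"
    have st: "s i = t" "c i = 1" if "i \<in> J" for i
      using sc[OF that] level_eq by auto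
    have "count (terms ((\<Sum>i\<in>J. monomial (c i) (s i)) + y)) t =
      (\<Sum>i\<in>J. if s i = t then c i else 0)"
      by (simp only: terms_add count_union count_sum_monomials count_terms_lower[OF y] add_0_right)
    also have "\<dots> = (\<Sum>i\<in>J. 1)"
      using st by (intro sum.cong) auto
    finally have "count (terms ((\<Sum>i\<in>J. monomial (c i) (s i)) + y)) t = card J"
      by simp
    moreover have "even (count (terms ((\<Sum>i\<in>J. monomial (c i) (s i)) + y)) t)"
      using P by blast
    ultimately have "even (card J)" by (simp only:)
    moreover have "even n \<Longrightarrow> (\<Sum>i<n. emb t) \<in> A0" for n :: nat
    proof (induction n rule: less_induct)
      case (less n)
      show ?case
      proof (cases "n = 0")
        case False
        then obtain l where n: "n = Suc (Suc l)" using less.prems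
          by (metis not0_implies_Suc odd_one One_nat_def)
        then have "(\<Sum>i<l. emb t) + t\<^sup>\<circ> \<in> A0"
          using less A0_add balance_in_A0 by simp
        then show ?thesis by (simp add: n balance_def mu ac_simps)
      qed (simp add: A0_zero)
    qed
    moreover have "(\<Sum>i\<in>J. emb (s i)) = (\<Sum>i<card J. emb t)"
    proof -
      have "(\<Sum>i\<in>J. emb (s i)) = (\<Sum>i\<in>J. emb t)" by (intro sum.cong) (auto simp: st)
      also have "\<dots> = (\<Sum>i<card J. emb t)"
        using J(1) by (induction J rule: finite_induct) (simp_all add: add.commute)
      finally show ?thesis .
    qed
    ultimately show "(\<Sum>i\<in>J. emb (s i)) \<in> A0" by simp
  qed auto
qed

text \<open>Here each level is a pair \<open>{t, (-)t}\<close> of distinct elements and addition is idempotent on \<open>\<T>\<close>. Idempotent sums cannot be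
cancelled, so the residues are taken to be the integers: the residue at \<open>t\<close> is the number of occurrences of \<open>t\<close> minus that of \<open>(-)t\<close>.
A vanishing integer combination with positive coefficients contains both signs, and then the sum in \<open>\<A>\<close> is \<open>t\<^sup>\<circ>\<close>.\<close>

lemma signed_count_ideal:
  assumes ne: "emb 1 + 1\<^sup>\<circ> \<noteq> emb 1" and mu: "\<mu> \<noteq> 1"
  shows "leading_coefficient_ideal lact ract emb A0 neg
    {x. \<forall>s. count (terms x) s = count (terms x) (\<mu> * s)} {0<..}"
    (is "leading_coefficient_ideal _ _ _ _ _ ?P _")
proof -
  have level_cases': "b = a \<or> b = \<mu> * a" if "a \<asymp> b" for a b
    using level_cases[OF that] ne by auto
  have mu_ne: "t \<noteq> \<mu> * t" for t
    using mu mult_cancel[of t 1 \<mu>] by (simp add: mult.commute)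
  \<comment> \<open>As \<open>(-)1 \<noteq> 1\<close>, the sum \<open>c = 1 + 1\<close> is tangible. If \<open>c \<noteq> 1\<close>, then \<open>c + (-)1 = 1 + 1\<^sup>\<circ>\<close> is tangible too,
    and unique negation makes it \<open>1\<close>, against the hypothesis.\<close>
  have one_one: "emb 1 + emb 1 = emb 1"
  proof -
    obtain c where c: "emb c = emb 1 + emb 1"
      using tangible_sum[of 1 1] mu by auto
    have c': "emb 1 + 1\<^sup>\<circ> = emb c + emb \<mu>" by (simp add: c balance_def ac_simps)
    show ?thesis
    proof (cases "\<mu> = \<mu> * c")
      case True
      then have "c = 1" using mult_cancel[of \<mu> 1 c] by simp
      then show ?thesis using c by simp
    next
      case False
      then obtain d where d: "emb d = emb c + emb \<mu>" using tangible_sum by blast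
      have "emb d + emb \<mu> = 1\<^sup>\<circ> + 1\<^sup>\<circ>" by (simp add: d c balance_def ac_simps)
      then have "emb d + emb \<mu> \<in> A0" using A0_add balance_in_A0 by simp
      then have "\<mu> * 1 = \<mu> * d" by (simp add: sum_in_A0_iff)
      then have "d = 1" unfolding mult_cancel by simp
      then show ?thesis using c' d ne by simp
    qed
  qed
  have idem: "emb t + emb t = emb t" for t
  proof -
    have "t \<cdot>\<^sub>l (emb 1 + emb 1) = t \<cdot>\<^sub>l emb 1" by (simp only: one_one)
    then show ?thesis by (simp add: lact_add lact_emb)
  qed
  have idem_sum: "(\<Sum>i\<in>J. emb t) = emb t" if "finite J" "J \<noteq> {}" for J :: "nat set" and t
    using that by (induction J rule: finite_ne_induct) (auto simp: idem)
  have opp: "monomial k t + monomial k (\<mu> * t) \<in> ?P" for k t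
    using minus_eq_iff by auto
  show ?thesis
  proof unfold_locales
    show "0 \<in> ?P" by simp
  next
    fix x y assume x: "x \<in> ?P" and y: "y \<in> ?P"
    have "count (terms (x + y)) s = count (terms (x + y)) (\<mu> * s)" for s
    proof -
      have "count (terms x) s = count (terms x) (\<mu> * s)"
        "count (terms y) s = count (terms y) (\<mu> * s)" using x y by blast+
      then show ?thesis by (simp only: terms_add count_union)
    qed
    then show "x + y \<in> ?P" by blast
  next
    fix x y assume x: "x \<in> ?P" and xy: "x + y \<in> ?P"
    have "count (terms y) s = count (terms y) (\<mu> * s)" for s
    proof -
      have "count (terms x) s = count (terms x) (\<mu> * s)"
        "count (terms (x + y)) s = count (terms (x + y)) (\<mu> * s)" using x xy by blast+
      then show ?thesis by (simp only: terms_add count_union add_left_cancel)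
    qed
    then show "y \<in> ?P" by blast
  next
    fix x u assume x: "x \<in> ?P"
    have "count (image_mset ((*) u) (terms x)) s = count (image_mset ((*) u) (terms x)) (\<mu> * s)" for s
    proof (cases "\<exists>v. s = u * v")
      case True
      then obtain v where "s = u * v" "\<mu> * s = u * (\<mu> * v)" by (auto simp: mult.left_commute)
      moreover have "count (terms x) v = count (terms x) (\<mu> * v)" using x by blast
      ultimately show ?thesis by (simp only: count_shift)
    next
      case False
      then have "\<mu> * s \<noteq> u * v" for v by (metis minus_minus mult.left_commute)
      then show ?thesis using False by (simp add: count_shift_outside)
    qed
    then have "count (terms (monomial 1 u * x)) s = count (terms (monomial 1 u * x)) (\<mu> * s)" for s
      by (simp only: One_nat_def terms_monomial_times)
    then show "monomial 1 u * x \<in> ?P" by blast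
  next
    show "1 + monomial 1 \<mu> \<in> ?P"
      using opp[of 1 1] by simp
  next
    fix k t u assume k: "k \<in> {0::nat<..}" and "t \<asymp> u"
    then consider "u = t" | "u = \<mu> * t" using level_cases' by blast
    then show "monomial k t + monomial 1 u \<in> ?P \<or>
      (\<exists>k'\<in>{0<..}. \<exists>t'. k' \<le> Suc k \<and> t' \<asymp> t \<and>
        monomial k t + monomial 1 u + monomial 1 \<mu> * monomial k' t' \<in> ?P)"
    proof cases
      case 1
      have "monomial k t + monomial 1 u + monomial 1 \<mu> * monomial (Suc k) t =
        monomial (Suc k) t + monomial (Suc k) (\<mu> * t)"
        by (simp add: 1 monomial_add monomial_mult)
      then show ?thesis using opp[of "Suc k" t]
        by (intro disjI2 bexI[of _ "Suc k"] exI[of _ t]) auto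
    next
      case 2
      obtain l where l: "k = Suc l" using k by (cases k) auto
      have "monomial k t + monomial 1 u + monomial 1 \<mu> * monomial l t =
        monomial k t + monomial k (\<mu> * t)"
        by (simp add: 2 l monomial_add monomial_mult add.assoc)
      then have "monomial k t + monomial 1 u + monomial 1 \<mu> * monomial l t \<in> ?P"
        using opp[of k t] by simp
      then have in_P: "monomial k t + monomial 1 u + monomial 1 \<mu> * monomial l t \<in> ?P" .
      show ?thesis
      proof (cases "l = 0")
        case True
        then show ?thesis using in_P by (simp only: monomial_0 mult_zero_right add_0_right simp_thms)
      next
        case False
        then show ?thesis using in_P
          by (intro disjI2 bexI[of _ l] exI[of _ t]) (auto simp only: l level_refl greaterThan_iff
              simp_thms intro: gr0I)
      qed
    qed
  next
    fix J :: "nat set" and s t c y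
    assume J: "finite J" "J \<noteq> {}" and sc: "\<And>i. i \<in> J \<Longrightarrow> s i \<asymp> t \<and> c i \<in> {0::nat<..}"
      and y: "lower t y" and P: "(\<Sum>i\<in>J. monomial (c i) (s i)) + y \<in> ?P"
    define J1 where "J1 = {i\<in>J. s i = t}"
    define J2 where "J2 = {i\<in>J. s i = \<mu> * t}"
    have "s i = t \<or> s i = \<mu> * t" if "i \<in> J" for i
      using sc[OF that] level_cases'[of t "s i"] level_sym by blast
    then have J12: "J = J1 \<union> J2" "J1 \<inter> J2 = {}" "finite J1" "finite J2"
      using J(1) mu_ne unfolding J1_def J2_def by auto
    have "lower (\<mu> * t) y" using y lower_def below_minus_right by simp
    moreover have "count (terms ((\<Sum>i\<in>J. monomial (c i) (s i)) + y)) t =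
      count (terms ((\<Sum>i\<in>J. monomial (c i) (s i)) + y)) (\<mu> * t)"
      using P by blast
    ultimately have "(\<Sum>i\<in>J. if s i = t then c i else 0) = (\<Sum>i\<in>J. if s i = \<mu> * t then c i else 0)"
      using count_terms_lower[OF y] count_terms_lower[of "\<mu> * t" y] by (simp add: count_sum_monomials)
    then have "(\<Sum>i\<in>J1. c i) = (\<Sum>i\<in>J2. c i)"
      unfolding J1_def J2_def sum.inter_filter[OF J(1)] .
    moreover have "(\<Sum>i\<in>J'. c i) = 0 \<longleftrightarrow> J' = {}" if "J' \<subseteq> J" for J'
    proof -
      have "c i \<noteq> 0" if "i \<in> J'" for i
        using sc[of i] that \<open>J' \<subseteq> J\<close> by auto
      then show ?thesis
        using finite_subset[OF \<open>J' \<subseteq> J\<close> J(1)] by auto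
    qed
    ultimately have "J1 = {} \<longleftrightarrow> J2 = {}"
      using J12(1) by (metis Un_upper1 Un_upper2)
    then have "J1 \<noteq> {}" "J2 \<noteq> {}"
      using J12(1) J(2) by auto
    have "(\<Sum>i\<in>J. emb (s i)) = (\<Sum>i\<in>J1. emb (s i)) + (\<Sum>i\<in>J2. emb (s i))"
      using J12 by (simp add: sum.union_disjoint)
    also have "\<dots> = (\<Sum>i\<in>J1. emb t) + (\<Sum>i\<in>J2. emb (\<mu> * t))"
      by (simp add: J1_def J2_def)
    also have "\<dots> = t\<^sup>\<circ>"
      using idem_sum J12 \<open>J1 \<noteq> {}\<close> \<open>J2 \<noteq> {}\<close> by (simp add: balance_def)
    finally show "(\<Sum>i\<in>J. emb (s i)) \<in> A0" by (simp add: balance_in_A0)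
  qed simp_all
qed

lemma exists_leading_coefficient_ideal:
  "\<exists>P K. leading_coefficient_ideal lact ract emb A0 neg P K"
  using residue_group_ideal parity_ideal signed_count_ideal by blast

section \<open>Dependence of rows\<close>

text \<open>Add the terms of a spanning expression one at a time; whenever the tangible part leaves \<open>\<T>\<^sub>0\<close>, it lands in \<open>\<A>\<^sub>0\<close>
and joins the other summand.\<close>

lemma tangible_plus_A0:
  "\<exists>y z. y \<in> insert 0 (range emb) \<and> z \<in> A0 \<and> x = y + z"
proof -
  obtain xs where "set xs \<subseteq> insert 0 (range emb)" and x: "x = sum_list xs"
    using T0_spans by blast
  have "\<exists>y z. y \<in> insert 0 (range emb) \<and> z \<in> A0 \<and> sum_list xs = y + z"
    using \<open>set xs \<subseteq> insert 0 (range emb)\<close>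
  proof (induction xs)
    case Nil
    then show ?case using A0_zero by (auto intro!: exI[of _ 0])
  next
    case (Cons w xs)
    then have "set xs \<subseteq> insert 0 (range emb)" and w: "w \<in> insert 0 (range emb)" by auto
    then obtain y z where yz: "y \<in> insert 0 (range emb)" "z \<in> A0" "sum_list xs = y + z"
      using Cons.IH by blast
    have sum: "sum_list (w # xs) = (w + y) + z" using yz by (simp add: add.assoc)
    have "w + y \<in> insert 0 (range emb) \<or> w + y \<in> A0"
      using yz(1) w T_add by auto
    then show ?case
    proof
      assume "w + y \<in> insert 0 (range emb)"
      then show ?thesis using sum yz(2) by blast
    next
      assume "w + y \<in> A0"
      then have "(w + y) + z \<in> A0" using yz(2) A0_add by blast
      moreover have "sum_list (w # xs) = 0 + ((w + y) + z)" using sum by simp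
      ultimately show ?thesis by blast
    qed
  qed
  then show ?thesis using x by simp
qed

text \<open>The \<open>\<A>\<^sub>0\<close>-parts of the entries contribute only elements of \<open>\<A>\<^sub>0\<close>, so tangible parts decide.\<close>

lemma rows_dependent:
  fixes I :: "nat set" and x :: "nat \<Rightarrow> nat \<Rightarrow> 'a"
  assumes "finite I" and "n < card I"
  shows "\<exists>I' a. I' \<subseteq> I \<and> I' \<noteq> {} \<and> (\<forall>j<n. (\<Sum>i\<in>I'. a i \<cdot>\<^sub>l x i j) \<in> A0)"
proof -
  obtain P K where "leading_coefficient_ideal lact ract emb A0 neg P K"
    using exists_leading_coefficient_ideal by blast
  then interpret leading_coefficient_ideal lact ract emb A0 neg P K .
  obtain Y Z where YZ: "\<And>w. Y w \<in> insert 0 (range emb) \<and> Z w \<in> A0 \<and> w = Y w + Z w"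
    using tangible_plus_A0 by metis
  define y z where "y i j = Y (x i j)" and "z i j = Z (x i j)" for i j
  have y: "y i j \<in> insert 0 (range emb)" and z: "z i j \<in> A0"
    and x: "x i j = y i j + z i j" for i j
    using YZ[of "x i j"] by (simp_all add: y_def z_def)
  obtain I' a where I': "I' \<subseteq> I" "I' \<noteq> {}" and a: "\<forall>j<n. (\<Sum>i\<in>I'. a i \<cdot>\<^sub>l y i j) \<in> A0"
    using tangible_rows_dependent[of I n y, OF assms y] by blast
  have "(\<Sum>i\<in>I'. a i \<cdot>\<^sub>l z i j) \<in> A0" for j
    by (induction I' rule: infinite_finite_induct) (simp_all add: A0_zero A0_add A0_lact z)
  then have "(\<Sum>i\<in>I'. a i \<cdot>\<^sub>l x i j) \<in> A0" if "j < n" for j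
    using a that A0_add by (simp add: x lact_add sum.distrib)
  then show ?thesis using I' by blast
qed

end

theorem theorem17:
  fixes lact :: "'t::comm_monoid_mult \<Rightarrow> 'a::comm_monoid_add \<Rightarrow> 'a"
    and ract :: "'a \<Rightarrow> 't \<Rightarrow> 'a"
    and emb :: "'t \<Rightarrow> 'a"
    and A0 :: "'a set"
    and neg :: "'a \<Rightarrow> 'a"
    and M :: "'a mat"
    and m n :: nat
  assumes "standing_pair lact ract emb A0"
    and "metatangible_pair lact ract emb A0 neg"
    and "uniquely_negated_pair lact ract emb A0 neg"
    and "M \<in> carrier_mat m n"
    and "m > n"
  shows "dependent_vecs lact A0 n {..<m} (row M)"
proof -
  interpret negated_metatangible_pair lact ract emb A0 neg
    using assms(1-3) by (simp add: negated_metatangible_pair_def)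
  obtain I' a where I': "I' \<subseteq> {..<m}" "I' \<noteq> {}"
    and a: "\<And>j. j < n \<Longrightarrow> (\<Sum>i\<in>I'. lact (a i) (M $$ (i, j))) \<in> A0"
    using rows_dependent[of "{..<m}" n "\<lambda>i j. M $$ (i, j)"] \<open>m > n\<close> by auto
  have "(\<Sum>i\<in>I'. lact (a i) (row M i $ j)) = (\<Sum>i\<in>I'. lact (a i) (M $$ (i, j)))" if "j < n" for j
    using that I'(1) \<open>M \<in> carrier_mat m n\<close> by (intro sum.cong) auto
  then show ?thesis
    unfolding dependent_vecs_def A0_vec_def
    using I' a finite_subset[OF I'(1)] by (intro exI[of _ I'] exI[of _ a]) auto
qed

end
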